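(* Let $V,\Lambda,\mu_s,\mu_o>0$, and consider hourly wages $w_s>0$ with $V\ge\overline{C}_s:=\frac{w_s}{\mu_s}+2\sqrt{\frac{w_s}{\Lambda\mu_s}}$ and supply pools $K>0$. Let $LW^S,CS^S,SW^S$ (resp. $LW^O,CS^O,SW^O$) denote labor welfare, consumer surplus and social welfare at the optimal policy of the service provider under System S (standard service with employees) (resp. System O, on-demand service with contractors). Then there exist thresholds $\underline K_L(w_s),\overline K_L(w_s),\underline K_C(w_s),\overline K_C(w_s),K_S(w_s)$ (extended real numbers) such that: (i) $LW^O>LW^S$ if and only if $\underline K_L(w_s)<K<\overline K_L(w_s)$; (ii) $CS^O>CS^S$ if and only if $\underline K_C(w_s)<K<\overline K_C(w_s)$; (iii) $SW^O>SW^S$ if and only if $K>K_S(w_s)$. Besides, $\underline K_L(w_s)\le\overline K_L(w_s)$ and $\underline K_C(w_s)\le\overline K_C(w_s)$ for all such $w_s$, and, as functions of $w_s$, $\underline K_L$ is quasi-concave, $\overline K_L$ is quasi-convex, $\underline K_C$ increases, and $\overline K_C$ and $K_S$ decrease.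
   Context: Customers arrive at rate $\Lambda$, have types $\theta$ uniform on $[0,1]$, and join service $i$ iff $U_i=V-p_i-\theta W_i\ge0$ ($p_i$ price, $W_i$ lead time). System S: the service provider (SP) chooses price $p_s$ and number $k_s\ge0$ of employees (service rate $\mu_s$, hourly wage $w_s$); $\lambda_s=\Lambda\Pr(U_s\ge0)$, $W_s=1/(k_s\mu_s-\lambda_s)$ with $k_s\mu_s>\lambda_s$; the SP maximizes $p_s\lambda_s-w_sk_s$ (optimal value $\pi^S$). When $V=\overline{C}_s$, where the optimum is not unique, the optimal policy with $\lambda_s=\Lambda$ is taken. System O: the SP chooses price $p_o$ and per-service wage $w_o$; there is a pool of $K$ contractors (service rate $\mu_o$) with reservation rates $r$ uniform on $[0,1]$, and $\lambda_o=\Lambda\Pr(U_o\ge0)$, $W_o=1/(k_o\mu_o-\lambda_o)$ with $k_o\mu_o>\lambda_o$, and the number $k_o$ of participating contractors satisfies $k_o=K\Pr(\lambda_ow_o/k_o\ge r)$, where the uniform distribution function is taken to be $x\mapsto x$, i.e. $k_o^2=K\lambda_ow_o$; the SP maximizes $p_o\lambda_o-\lambda_ow_o$ (optimal value $\pi^O$). At the optimal policies: consumer surplus $CS=\Lambda\int_0^1\max\{U_i,0\}\,d\theta$ with $i=s$ for System S and $i=o$ for System O; labor welfare $$LW^S=k_sw_s-k_s\int_0^{w_s}r\,dr,\qquad LW^O=K\int_0^{\lambda_ow_o/k_o}\Big(\frac{\lambda_ow_o}{k_o}-r\Big)dr;$$ social welfare is the sum of SP profit, labor welfare and consumer surplus,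 $SW^S=\pi^S+LW^S+CS^S$ and $SW^O=\pi^O+LW^O+CS^O$. *)

theory Defs
  imports "HOL-Probability.Probability"
begin

definition quasiconvex_on :: "'a::real_vector set \<Rightarrow> ('a \<Rightarrow> 'b::linorder) \<Rightarrow> bool"
  where "quasiconvex_on S f \<longleftrightarrow> convex S \<and>
    (\<forall>x\<in>S. \<forall>y\<in>S. \<forall>u\<ge>0. \<forall>v\<ge>0. u + v = 1 \<longrightarrow>
      f (u *\<^sub>R x + v *\<^sub>R y) \<le> max (f x) (f y))"

definition quasiconcave_on :: "'a::real_vector set \<Rightarrow> ('a \<Rightarrow> 'b::linorder) \<Rightarrow> bool"
  where "quasiconcave_on S f \<longleftrightarrow> convex S \<and>
    (\<forall>x\<in>S. \<forall>y\<in>S. \<forall>u\<ge>0. \<forall>v\<ge>0. u + v = 1 \<longrightarrow>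
      min (f x) (f y) \<le> f (u *\<^sub>R x + v *\<^sub>R y))"

definition utility :: "real \<Rightarrow> real \<Rightarrow> real \<Rightarrow> real \<Rightarrow> real"
  where "utility V p W \<theta> = V - p - \<theta> * W"

definition lead_time :: "real \<Rightarrow> real \<Rightarrow> real \<Rightarrow> real"
  where "lead_time \<mu> k lam = 1 / (k * \<mu> - lam)"

definition demand :: "real \<Rightarrow> real \<Rightarrow> real \<Rightarrow> real \<Rightarrow> real"
  where "demand V \<Lambda> p W =
    \<Lambda> * \<P>(\<theta> in uniform_measure lborel {0..1}. utility V p W \<theta> \<ge> 0)"

definition consumer_surplus :: "real \<Rightarrow> real \<Rightarrow> real \<Rightarrow> real \<Rightarrow> real"
  where "consumer_surplus V \<Lambda> p W = \<Lambda> * integral {0..1} (\<lambda>\<theta>. max (utility V p W \<theta>) 0)"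

text \<open>
  Standard service with employees. A policy is a triple \<open>(p, k, lam)\<close> of price, number of
  employees and arrival rate. The provider chooses \<open>p\<close> and \<open>k\<close>; the rate \<open>lam\<close> is pinned down by
  the equilibrium equation in \<open>feasible_S\<close>. Numbers of servers are real-valued.
\<close>

definition Cbar :: "real \<Rightarrow> real \<Rightarrow> real \<Rightarrow> real"
  where "Cbar \<Lambda> \<mu> w = w / \<mu> + 2 * sqrt (w / (\<Lambda> * \<mu>))"

fun feasible_S :: "real \<Rightarrow> real \<Rightarrow> real \<Rightarrow> real \<times> real \<times> real \<Rightarrow> bool"
  where "feasible_S V \<Lambda> \<mu> (p, k, lam) \<longleftrightarrow>
    k \<ge> 0 \<and> k * \<mu> > lam \<and> lam = demand V \<Lambda> p (lead_time \<mu> k lam)"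

fun profit_S :: "real \<Rightarrow> real \<times> real \<times> real \<Rightarrow> real"
  where "profit_S w (p, k, lam) = p * lam - w * k"

text \<open>
  For \<open>V = Cbar \<Lambda> \<mu> w\<close> the provider is indifferent between all positive arrival rates up to \<open>\<Lambda>\<close>;
  the tie is broken in favour of \<open>\<Lambda>\<close>. The description below is unique whenever
  \<open>V \<ge> Cbar \<Lambda> \<mu> w\<close> and all parameters are positive.
\<close>

definition optimal_S :: "real \<Rightarrow> real \<Rightarrow> real \<Rightarrow> real \<Rightarrow> real \<times> real \<times> real"
  where "optimal_S V \<Lambda> \<mu> w = (THE (p, k, lam).
    is_arg_max (profit_S w) (feasible_S V \<Lambda> \<mu>) (p, k, lam) \<and>
    (V = Cbar \<Lambda> \<mu> w \<longrightarrow> lam = \<Lambda>))"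

definition profit_opt_S :: "real \<Rightarrow> real \<Rightarrow> real \<Rightarrow> real \<Rightarrow> real"
  where "profit_opt_S V \<Lambda> \<mu> w = profit_S w (optimal_S V \<Lambda> \<mu> w)"

definition LW_S :: "real \<Rightarrow> real \<Rightarrow> real \<Rightarrow> real \<Rightarrow> real"
  where "LW_S V \<Lambda> \<mu> w =
    (case optimal_S V \<Lambda> \<mu> w of (p, k, lam) \<Rightarrow> k * w - k * integral {0..w} (\<lambda>r. r))"

definition CS_S :: "real \<Rightarrow> real \<Rightarrow> real \<Rightarrow> real \<Rightarrow> real"
  where "CS_S V \<Lambda> \<mu> w =
    (case optimal_S V \<Lambda> \<mu> w of (p, k, lam) \<Rightarrow> consumer_surplus V \<Lambda> p (lead_time \<mu> k lam))"

definition SW_S :: "real \<Rightarrow> real \<Rightarrow> real \<Rightarrow> real \<Rightarrow> real"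
  where "SW_S V \<Lambda> \<mu> w = profit_opt_S V \<Lambda> \<mu> w + LW_S V \<Lambda> \<mu> w + CS_S V \<Lambda> \<mu> w"

text \<open>
  On-demand service with contractors. A policy is a tuple \<open>(p, w, k, lam)\<close> of price, per-service
  wage, number of participating contractors and arrival rate. The provider chooses \<open>p\<close> and \<open>w\<close>;
  \<open>k\<close> and \<open>lam\<close> are determined by the equilibrium equations in \<open>feasible_O\<close>. The participation
  condition \<open>k = K * Pr (lam * w / k \<ge> r)\<close> uses the untruncated distribution function \<open>x \<mapsto> x\<close> for
  the reservation rates, hence \<open>k\<^sup>2 = K * lam * w\<close>, and \<open>k\<close> is not capped at \<open>K\<close>.
\<close>

fun feasible_O :: "real \<Rightarrow> real \<Rightarrow> real \<Rightarrow> real \<Rightarrow> real \<times> real \<times> real \<times> real \<Rightarrow> bool"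
  where "feasible_O V \<Lambda> \<mu> K (p, w, k, lam) \<longleftrightarrow>
    k \<ge> 0 \<and> k\<^sup>2 = K * lam * w \<and> k * \<mu> > lam \<and> lam = demand V \<Lambda> p (lead_time \<mu> k lam)"

fun profit_O :: "real \<times> real \<times> real \<times> real \<Rightarrow> real"
  where "profit_O (p, w, k, lam) = p * lam - lam * w"

text \<open>The description below is unique whenever all parameters are positive.\<close>

definition optimal_O :: "real \<Rightarrow> real \<Rightarrow> real \<Rightarrow> real \<Rightarrow> real \<times> real \<times> real \<times> real"
  where "optimal_O V \<Lambda> \<mu> K = (THE x. is_arg_max profit_O (feasible_O V \<Lambda> \<mu> K) x)"

definition profit_opt_O :: "real \<Rightarrow> real \<Rightarrow> real \<Rightarrow> real \<Rightarrow> real"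
  where "profit_opt_O V \<Lambda> \<mu> K = profit_O (optimal_O V \<Lambda> \<mu> K)"

definition LW_O :: "real \<Rightarrow> real \<Rightarrow> real \<Rightarrow> real \<Rightarrow> real"
  where "LW_O V \<Lambda> \<mu> K =
    (case optimal_O V \<Lambda> \<mu> K of (p, w, k, lam) \<Rightarrow>
      K * integral {0..lam * w / k} (\<lambda>r. lam * w / k - r))"

definition CS_O :: "real \<Rightarrow> real \<Rightarrow> real \<Rightarrow> real \<Rightarrow> real"
  where "CS_O V \<Lambda> \<mu> K =
    (case optimal_O V \<Lambda> \<mu> K of (p, w, k, lam) \<Rightarrow> consumer_surplus V \<Lambda> p (lead_time \<mu> k lam))"

definition SW_O :: "real \<Rightarrow> real \<Rightarrow> real \<Rightarrow> real \<Rightarrow> real"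
  where "SW_O V \<Lambda> \<mu> K = profit_opt_O V \<Lambda> \<mu> K + LW_O V \<Lambda> \<mu> K + CS_O V \<Lambda> \<mu> K"

end

theory Submission
  imports Defs
begin

text \<open>
  Write \<open>l\<close> for the arrival rate and \<open>d = k * \<mu> - l\<close> for the excess capacity. The best price for
  given \<open>l\<close> and \<open>d\<close> is \<open>V - l / (\<Lambda> * d)\<close>. With employees the profit is then homogeneous of
  degree one in \<open>(l, d)\<close>, and maximising over \<open>d\<close> leaves \<open>l * (V - Cbar)\<close>, so \<open>l = \<Lambda>\<close>: labor
  welfare is concave in the wage, consumer surplus increases and social welfare decreases.
  With contractors the profit is strictly concave in \<open>(l, d)\<close>. At its maximum \<open>l = \<Lambda> * X\<close> and
  \<open>d = X * t\<close>; for small \<open>K\<close> the ratio \<open>t\<close> is constant and \<open>X\<close> is proportional to \<open>K\<close>, and once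
  \<open>X\<close> has reached \<open>1\<close> only \<open>t\<close> grows. Labor welfare and consumer surplus are \<open>X\<close> times a
  decreasing function of \<open>t\<close>, hence unimodal in \<open>K\<close>, while social welfare is \<open>X\<close> times an
  increasing function of \<open>t\<close>. The thresholds are the end points of the superlevel sets of these
  continuous functions of \<open>K\<close>.
\<close>

section \<open>Superlevel sets of unimodal and of increasing functions\<close>

lemma continuous_superlevel_cball:
  fixes f :: "real \<Rightarrow> real"
  assumes "continuous_on {0<..} f" and "K > 0" and "c < f K"
  obtains e where "e > 0" and "{K - e..K + e} \<subseteq> {K. 0 < K \<and> c < f K}"
proof -
  have "open ({0<..} \<inter> f -` {c<..})"
    using assms(1) continuous_on_open_vimage[of "{0<..}" f] by (simp add: Int_commute)
  moreover have "{0<..} \<inter> f -` {c<..} = {K. 0 < K \<and> c < f K}"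
    by auto
  ultimately show ?thesis
    using assms(2,3) that
    by (metis (no_types, lifting) cball_eq_atLeastAtMost mem_Collect_eq open_contains_cball)
qed

text \<open>A nonempty superlevel set contains the peak \<open>a\<close>, so adding \<open>a\<close>
  does not move its infimum and supremum; an empty one gets both thresholds equal to
  \<open>a\<close>, hence no \<open>K\<close> between them. Superlevel sets shrink as
  \<open>c\<close> grows, which makes \<open>lo\<close> increase and \<open>hi\<close>
  decrease.\<close>

lemma unimodal_superlevel:
  fixes f :: "real \<Rightarrow> real"
  assumes cont: "continuous_on {0<..} f" and "a > 0"
    and up: "mono_on {0<..a} f" and down: "antimono_on {a..} f"
  obtains lo hi :: "real \<Rightarrow> ereal"
  where "\<And>c K. K > 0 \<Longrightarrow> c < f K \<longleftrightarrow> lo c < ereal K \<and> ereal K < hi c"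
    and "\<And>c. lo c \<le> hi c" and "mono lo" and "antimono hi"
proof -
  define S where "S c = {K. 0 < K \<and> c < f K}" for c
  define lo where "lo c = Inf (insert (ereal a) (ereal ` S c))" for c
  define hi where "hi c = Sup (insert (ereal a) (ereal ` S c))" for c
  have antiS: "S d \<subseteq> S c" if "c \<le> d" for c d
    using that by (auto simp: S_def)
  have "c < f K \<longleftrightarrow> lo c < ereal K \<and> ereal K < hi c" if K: "K > 0" for c K
  proof
    assume *: "c < f K"
    \<comment> \<open>Continuity leaves room on both sides of \<open>K\<close>, which makes both
      inequalities strict.\<close>
    then obtain e where e: "e > 0" "{K - e..K + e} \<subseteq> S c"
      using continuous_superlevel_cball[OF cont K] unfolding S_def by blast
    then have "K - e \<in> S c" "K + e \<in> S c"
      by (auto simp: subset_iff)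
    then have "lo c \<le> ereal (K - e)" "ereal (K + e) \<le> hi c"
      unfolding lo_def hi_def by (blast intro: Inf_lower Sup_upper)+
    moreover have "ereal (K - e) < ereal K" "ereal K < ereal (K + e)" using e by auto
    ultimately show "lo c < ereal K \<and> ereal K < hi c"
      by (meson le_less_trans less_le_trans)
  next
    assume *: "lo c < ereal K \<and> ereal K < hi c"
    obtain y where y: "y \<in> insert (ereal a) (ereal ` S c)" "y < ereal K"
      using * unfolding lo_def Inf_less_iff by blast
    obtain z where z: "z \<in> insert (ereal a) (ereal ` S c)" "ereal K < z"
      using * unfolding hi_def less_Sup_iff by blast
    \<comment> \<open>Up to the peak, the point below \<open>K\<close> cannot be \<open>a\<close>,
      so it lies in the superlevel set and \<open>f\<close> only rises from there to
      \<open>K\<close>. Beyond the peak the point above \<open>K\<close> serves in the same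
      way.\<close>
    show "c < f K"
    proof (cases "K \<le> a")
      case True
      with y obtain r where "r \<in> S c" "r < K" by auto
      then show ?thesis
        using mono_onD[OF up, of r K] True by (auto simp: S_def)
    next
      case False
      with z obtain r where "r \<in> S c" "K < r" by auto
      then show ?thesis
        using monotone_onD[OF down, of K r] False by (auto simp: S_def)
    qed
  qed
  moreover have "lo c \<le> hi c" for c
    unfolding lo_def hi_def by (meson Inf_lower Sup_upper insertI1 order_trans)
  moreover have "mono lo"
  proof
    show "lo c \<le> lo d" if "c \<le> d" for c d
      unfolding lo_def using antiS[OF that] by (intro Inf_superset_mono) blast
  qed
  moreover have "antimono hi"
  proof
    show "hi d \<le> hi c" if "c \<le> d" for c d
      unfolding hi_def using antiS[OF that] by (intro Sup_subset_mono) blast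
  qed
  ultimately show ?thesis using that by blast
qed

text \<open>There is no peak to add here: an empty superlevel set has threshold \<infinity>.\<close>

lemma mono_superlevel:
  fixes f :: "real \<Rightarrow> real"
  assumes cont: "continuous_on {0<..} f" and up: "mono_on {0<..} f"
  obtains lo :: "real \<Rightarrow> ereal"
  where "\<And>c K. K > 0 \<Longrightarrow> c < f K \<longleftrightarrow> lo c < ereal K" and "mono lo"
proof -
  define S where "S c = {K. 0 < K \<and> c < f K}" for c
  define lo where "lo c = Inf (ereal ` S c)" for c
  have "c < f K \<longleftrightarrow> lo c < ereal K" if K: "K > 0" for c K
  proof
    assume *: "c < f K"
    then obtain e where e: "e > 0" "{K - e..K + e} \<subseteq> S c"
      using continuous_superlevel_cball[OF cont K] unfolding S_def by blast
    then have "K - e \<in> S c"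
      by (auto simp: subset_iff)
    then have "lo c \<le> ereal (K - e)"
      unfolding lo_def by (auto intro!: Inf_lower)
    also have "\<dots> < ereal K" using e by simp
    finally show "lo c < ereal K" .
  next
    assume "lo c < ereal K"
    then obtain r where "r \<in> S c" "r < K"
      unfolding lo_def by (auto simp: Inf_less_iff)
    then show "c < f K"
      using mono_onD[OF up, of r K] by (auto simp: S_def)
  qed
  moreover have "mono lo"
    unfolding mono_def lo_def
    by (auto simp: S_def intro!: Inf_superset_mono)
  ultimately show ?thesis using that by blast
qed

section \<open>Demand, consumer surplus and integrals over reservation rates\<close>

lemma demand_eq:
  assumes "W > 0"
  shows "demand V \<Lambda> p W = \<Lambda> * max 0 (min 1 ((V - p) / W))"
proof -
  have *: "{\<theta>. utility V p W \<theta> \<ge> 0} = {..(V - p) / W}"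
    using assms by (auto simp: utility_def field_simps)
  have "{0..1} \<inter> {..(V - p) / W} = {0..min 1 ((V - p) / W)}"
    by auto
  then have "measure (uniform_measure lborel {0..1}) {..(V - p) / W}
      = max 0 (min 1 ((V - p) / W))"
    by (subst measure_uniform_measure) (auto simp: max_def min_def)
  then show ?thesis by (simp add: demand_def *)
qed

text \<open>With lead time \<open>1 / d\<close> this price leaves type \<open>l / \<Lambda>\<close>
  indifferent, so exactly the types up to it join.\<close>

lemma demand_at_marginal_price:
  assumes "0 < l" "l \<le> \<Lambda>" "d > 0" "p = V - l / (\<Lambda> * d)"
  shows "demand V \<Lambda> p (1 / d) = l"
proof -
  have "(V - p) / (1 / d) = l / \<Lambda>" using assms by (simp add: field_simps)
  then show ?thesis using assms by (simp add: demand_eq)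
qed

text \<open>The price bound can be strict only when everybody joins. At \<open>l = 0\<close> nothing
  bounds the price from above, hence the restriction to \<open>l > 0\<close>.\<close>

lemma price_le_of_demand:
  assumes "\<Lambda> > 0" "d > 0" "demand V \<Lambda> p (1 / d) = l"
  shows "0 \<le> l" "l \<le> \<Lambda>" "l > 0 \<Longrightarrow> p \<le> V - l / (\<Lambda> * d)"
proof -
  have l: "l = \<Lambda> * max 0 (min 1 ((V - p) * d))"
    using assms by (simp add: demand_eq)
  show "0 \<le> l" "l \<le> \<Lambda>" using l assms by (auto simp: mult_le_cancel_left1)
  assume "l > 0"
  then have "l / \<Lambda> \<le> (V - p) * d"
    using l assms(1) by (auto simp: max_def min_def split: if_splits)
  then have "l / \<Lambda> / d \<le> V - p" using assms(2) by (subst pos_divide_le_eq)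
  then show "p \<le> V - l / (\<Lambda> * d)" by (simp add: divide_divide_eq_left)
qed

text \<open>Here \<open>x\<close> is the marginal type: utility is
  \<open>(x - \<theta>) * W\<close>, so the surplus is the area of a triangle with base
  \<open>x\<close> and height \<open>x * W\<close>.\<close>

lemma consumer_surplus_eq:
  assumes "W > 0" "0 \<le> x" "x \<le> 1" "V - p = x * W"
  shows "consumer_surplus V \<Lambda> p W = \<Lambda> * W * x\<^sup>2 / 2"
proof -
  have "((\<lambda>\<theta>. x * W - \<theta> * W) has_integral (x * W * x - W * x^2 / 2 - (x * W * 0 - W * 0^2 / 2))) {0..x}"
    using assms
    by (intro fundamental_theorem_of_calculus)
      (auto simp: has_real_derivative_iff_has_vector_derivative[symmetric]
        intro!: derivative_eq_intros)
  also have "x * W * x - W * x^2 / 2 - (x * W * 0 - W * 0^2 / 2) = W * x^2 / 2"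
    by (simp add: power2_eq_square)
  finally have 1: "((\<lambda>\<theta>. max (utility V p W \<theta>) 0) has_integral (W * x^2 / 2)) {0..x}"
  proof (rule has_integral_eq[rotated])
    fix \<theta> assume "\<theta> \<in> {0..x}"
    then show "x * W - \<theta> * W = max (utility V p W \<theta>) 0"
      using assms mult_right_mono[of \<theta> x W] by (auto simp: utility_def)
  qed
  have zero: "max (utility V p W \<theta>) 0 = 0" if "\<theta> \<in> {x..1}" for \<theta>
    using assms that mult_right_mono[of x \<theta> W] by (auto simp: utility_def)
  have 2: "((\<lambda>\<theta>. max (utility V p W \<theta>) 0) has_integral 0) {x..1}"
    by (intro has_integral_is_0 zero)
  have "((\<lambda>\<theta>. max (utility V p W \<theta>) 0) has_integral (W * x^2 / 2 + 0)) {0..1}"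
    by (rule has_integral_combine[OF assms(2,3) 1 2])
  then show ?thesis by (simp add: consumer_surplus_def integral_unique)
qed

lemma integral_ident_from_0:
  fixes a :: real
  assumes "0 \<le> a"
  shows "integral {0..a} (\<lambda>r. r) = a\<^sup>2 / 2" "integral {0..a} (\<lambda>r. a - r) = a\<^sup>2 / 2"
proof -
  have "((\<lambda>r. r) has_integral (a^2 / 2 - 0^2 / 2)) {0..a}"
    using assms by (intro fundamental_theorem_of_calculus)
      (auto simp: has_real_derivative_iff_has_vector_derivative[symmetric]
        intro!: derivative_eq_intros)
  then show "integral {0..a} (\<lambda>r. r) = a\<^sup>2 / 2" by (simp add: integral_unique)
  have "((\<lambda>r. a - r) has_integral ((a * a - a^2 / 2) - (a * 0 - 0^2 / 2))) {0..a}"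
    using assms by (intro fundamental_theorem_of_calculus)
      (auto simp: has_real_derivative_iff_has_vector_derivative[symmetric]
        intro!: derivative_eq_intros)
  then show "integral {0..a} (\<lambda>r. a - r) = a\<^sup>2 / 2"
    by (simp add: integral_unique power2_eq_square)
qed

section \<open>Employees\<close>

text \<open>For fixed \<open>l\<close>, the revenue \<open>l\<^sup>2 / (\<Lambda> * d)\<close> given
  up through the price and the cost \<open>w * d / \<mu>\<close> of excess capacity add up to
  \<open>2 * l / \<tau>\<close> plus the square, which vanishes at
  \<open>d = l * \<tau> / \<Lambda>\<close>. The last term is the loss from pricing below
  \<open>V - l / (\<Lambda> * d)\<close>.\<close>

lemma profit_S_le:
  assumes pos: "\<Lambda> > 0" "\<mu> > 0" "w > 0"
    and feas: "feasible_S V \<Lambda> \<mu> (p, k, l)" and "l > 0"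
  defines "\<tau> \<equiv> sqrt (\<Lambda> * \<mu> / w)" and "d \<equiv> k * \<mu> - l"
  shows "profit_S w (p, k, l) = l * (V - Cbar \<Lambda> \<mu> w)
      - (l * \<tau> - \<Lambda> * d)\<^sup>2 / (\<Lambda> * d * \<tau>\<^sup>2) - l * (V - l / (\<Lambda> * d) - p)"
proof -
  have d: "d > 0" and \<tau>: "\<tau> > 0" using assms by (auto simp: d_def)
  have \<tau>2: "\<tau>\<^sup>2 = \<Lambda> * \<mu> / w" using pos by (simp add: \<tau>_def)
  have w: "w = \<Lambda> * \<mu> / \<tau>\<^sup>2" using pos by (simp add: \<tau>2)
  have k: "k = (l + d) / \<mu>" using pos by (simp add: d_def)
  have "sqrt (w / (\<Lambda> * \<mu>)) = 1 / \<tau>"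
    using pos by (simp add: \<tau>_def real_sqrt_divide)
  then have C: "Cbar \<Lambda> \<mu> w = \<Lambda> / \<tau>\<^sup>2 + 2 / \<tau>"
    using pos by (simp add: Cbar_def w)
  show ?thesis
    unfolding profit_S.simps C k using pos d \<tau>
    by (subst w) (simp add: field_simps power2_eq_square)
qed

text \<open>For \<open>l > 0\<close>, \<open>profit_S_le\<close> splits the shortfall from the
  claimed optimum into three nonnegative losses, which all vanish at a maximiser. This forces
  \<open>l = \<Lambda>\<close> if \<open>V\<close> exceeds \<open>Cbar\<close>; at equality the tie
  rule does.\<close>

lemma optimal_S_eq:
  assumes pos: "\<Lambda> > 0" "\<mu> > 0" "w > 0" and V: "V \<ge> Cbar \<Lambda> \<mu> w"
  defines "\<tau> \<equiv> sqrt (\<Lambda> * \<mu> / w)"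
  shows "optimal_S V \<Lambda> \<mu> w = (V - 1 / \<tau>, (\<Lambda> + \<tau>) / \<mu>, \<Lambda>)"
    and "profit_opt_S V \<Lambda> \<mu> w = \<Lambda> * (V - Cbar \<Lambda> \<mu> w)"
proof -
  define p0 k0 where "p0 = V - 1 / \<tau>" and "k0 = (\<Lambda> + \<tau>) / \<mu>"
  have \<tau>: "\<tau> > 0" using pos by (simp add: \<tau>_def)
  have d0: "k0 * \<mu> - \<Lambda> = \<tau>" using pos by (simp add: k0_def)
  have feas0: "feasible_S V \<Lambda> \<mu> (p0, k0, \<Lambda>)"
    using demand_at_marginal_price[of \<Lambda> \<Lambda> \<tau> p0 V] pos \<tau> d0
    by (simp add: lead_time_def) (simp add: p0_def k0_def)
  have val0: "profit_S w (p0, k0, \<Lambda>) = \<Lambda> * (V - Cbar \<Lambda> \<mu> w)"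
    using profit_S_le[OF pos feas0 pos(1)] pos by (simp only: d0 flip: \<tau>_def) (simp add: p0_def)
  have le: "profit_S w (p, k, l) \<le> \<Lambda> * (V - Cbar \<Lambda> \<mu> w)"
    and eq: "profit_S w (p, k, l) = \<Lambda> * (V - Cbar \<Lambda> \<mu> w) \<Longrightarrow> V = Cbar \<Lambda> \<mu> w \<longrightarrow> l = \<Lambda>
      \<Longrightarrow> (p, k, l) = (p0, k0, \<Lambda>)"
    if feas: "feasible_S V \<Lambda> \<mu> (p, k, l)" for p k l
  proof -
    define d where "d = k * \<mu> - l"
    have d: "d > 0" "demand V \<Lambda> p (1 / d) = l"
      using feas by (auto simp: d_def lead_time_def)
    note pr = price_le_of_demand[OF pos(1) d]
    have "profit_S w (p, k, l) \<le> \<Lambda> * (V - Cbar \<Lambda> \<mu> w) \<and>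
      (profit_S w (p, k, l) = \<Lambda> * (V - Cbar \<Lambda> \<mu> w) \<longrightarrow> (V = Cbar \<Lambda> \<mu> w \<longrightarrow> l = \<Lambda>)
      \<longrightarrow> (p, k, l) = (p0, k0, \<Lambda>))"
    proof (cases "l = 0")
      \<comment> \<open>Without customers, feasibility still demands positive capacity, so wages are
        paid with no revenue.\<close>
      case True
      with feas have "k * \<mu> > 0" by simp
      then have "k > 0" using pos by (simp add: zero_less_mult_iff)
      then have "profit_S w (p, k, l) < 0" using pos True by simp
      moreover have "0 \<le> \<Lambda> * (V - Cbar \<Lambda> \<mu> w)" using pos V by simp
      ultimately show ?thesis by linarith
    next
      case False
      then have l: "l > 0" using pr(1) by simp
      define A B C where "A = (\<Lambda> - l) * (V - Cbar \<Lambda> \<mu> w)"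
        and "B = (l * \<tau> - \<Lambda> * d)\<^sup>2 / (\<Lambda> * d * \<tau>\<^sup>2)" and "C = l * (V - l / (\<Lambda> * d) - p)"
      have P: "profit_S w (p, k, l) = \<Lambda> * (V - Cbar \<Lambda> \<mu> w) - A - B - C"
        using profit_S_le[OF pos feas l] unfolding A_def B_def C_def d_def \<tau>_def
        by (simp add: algebra_simps)
      have nn: "A \<ge> 0" "B \<ge> 0" "C \<ge> 0"
        using pr(2) pr(3)[OF l] V d pos l by (auto simp: A_def B_def C_def)
      have "(p, k, l) = (p0, k0, \<Lambda>)"
        if "profit_S w (p, k, l) = \<Lambda> * (V - Cbar \<Lambda> \<mu> w)" "V = Cbar \<Lambda> \<mu> w \<longrightarrow> l = \<Lambda>"
      proof -
        have "A = 0" "B = 0" "C = 0" using P nn that(1) by linarith+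
        have "l = \<Lambda>" using \<open>A = 0\<close> that(2) by (auto simp: A_def)
        moreover have "d = \<tau>" using \<open>B = 0\<close> d \<tau> pos by (auto simp: B_def \<open>l = \<Lambda>\<close>)
        moreover have "p = p0" using \<open>C = 0\<close> l pos by (simp add: C_def p0_def \<open>l = \<Lambda>\<close> \<open>d = \<tau>\<close>)
        moreover have "k = k0" using \<open>d = \<tau>\<close> \<open>l = \<Lambda>\<close> pos by (simp add: k0_def d_def field_simps)
        ultimately show ?thesis by simp
      qed
      then show ?thesis using P nn by linarith
    qed
    then show "profit_S w (p, k, l) \<le> \<Lambda> * (V - Cbar \<Lambda> \<mu> w)"
      and "profit_S w (p, k, l) = \<Lambda> * (V - Cbar \<Lambda> \<mu> w) \<Longrightarrow> V = Cbar \<Lambda> \<mu> w \<longrightarrow> l = \<Lambda>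
      \<Longrightarrow> (p, k, l) = (p0, k0, \<Lambda>)" by blast+
  qed
  have opt: "optimal_S V \<Lambda> \<mu> w = (p0, k0, \<Lambda>)"
    unfolding optimal_S_def
  proof (rule the_equality)
    show "case (p0, k0, \<Lambda>) of (p, k, lam) \<Rightarrow>
        is_arg_max (profit_S w) (feasible_S V \<Lambda> \<mu>) (p, k, lam) \<and> (V = Cbar \<Lambda> \<mu> w \<longrightarrow> lam = \<Lambda>)"
      using feas0 val0 le unfolding is_arg_max_def by (auto simp: not_less simp del: profit_S.simps feasible_S.simps)
  next
    fix x assume x: "case x of (p, k, lam) \<Rightarrow>
        is_arg_max (profit_S w) (feasible_S V \<Lambda> \<mu>) (p, k, lam) \<and> (V = Cbar \<Lambda> \<mu> w \<longrightarrow> lam = \<Lambda>)"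
    obtain p k l where xe: "x = (p, k, l)" by (cases x)
    have feas: "feasible_S V \<Lambda> \<mu> (p, k, l)" and l: "V = Cbar \<Lambda> \<mu> w \<longrightarrow> l = \<Lambda>"
      and "\<not> profit_S w (p0, k0, \<Lambda>) > profit_S w (p, k, l)"
      using x feas0 unfolding xe is_arg_max_def by blast+
    then have "profit_S w (p, k, l) = \<Lambda> * (V - Cbar \<Lambda> \<mu> w)"
      using val0 le[OF feas] by linarith
    then show "x = (p0, k0, \<Lambda>)" using eq[OF feas] l xe by simp
  qed
  then show "optimal_S V \<Lambda> \<mu> w = (V - 1 / \<tau>, (\<Lambda> + \<tau>) / \<mu>, \<Lambda>)"
    by (simp add: p0_def k0_def)
  show "profit_opt_S V \<Lambda> \<mu> w = \<Lambda> * (V - Cbar \<Lambda> \<mu> w)"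
    using opt val0 by (simp add: profit_opt_S_def)
qed

lemma welfare_S:
  assumes pos: "\<Lambda> > 0" "\<mu> > 0" "w > 0" and V: "V \<ge> Cbar \<Lambda> \<mu> w"
  shows "LW_S V \<Lambda> \<mu> w = \<Lambda> / \<mu> * (w - w\<^sup>2 / 2) + sqrt (\<Lambda> / \<mu>) * (sqrt w - w * sqrt w / 2)"
    and "CS_S V \<Lambda> \<mu> w = sqrt (\<Lambda> / \<mu>) * sqrt w / 2"
    and "SW_S V \<Lambda> \<mu> w = \<Lambda> * V - sqrt (\<Lambda> / \<mu>) * sqrt w / 2 - \<Lambda> / \<mu> * w\<^sup>2 / 2
      - sqrt (\<Lambda> / \<mu>) * (w * sqrt w) / 2"
proof -
  define \<tau> where "\<tau> = sqrt (\<Lambda> * \<mu> / w)"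
  \<comment> \<open>In \<open>g\<close> and \<open>u\<close> the square roots disappear; in
    particular \<open>\<tau> = \<mu> * g / u\<close>.\<close>
  define g u where "g = sqrt (\<Lambda> / \<mu>)" and "u = sqrt w"
  have gu: "g > 0" "u > 0" using pos by (auto simp: g_def u_def)
  have w: "w = u\<^sup>2" using pos by (simp add: u_def)
  have L: "\<Lambda> = \<mu> * g\<^sup>2" using pos by (simp add: g_def)
  have "\<Lambda> * \<mu> / w = (\<mu> * g / u)\<^sup>2" unfolding w L by (simp add: power2_eq_square)
  then have \<tau>: "\<tau> = \<mu> * g / u" using pos gu by (simp add: \<tau>_def)
  have "w / (\<Lambda> * \<mu>) = (u / (\<mu> * g))\<^sup>2" unfolding w L by (simp add: power2_eq_square)
  then have "sqrt (w / (\<Lambda> * \<mu>)) = u / (\<mu> * g)" using pos gu by simp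
  then have C: "Cbar \<Lambda> \<mu> w = u\<^sup>2 / \<mu> + 2 * u / (\<mu> * g)"
    by (simp add: Cbar_def w)
  note opt = optimal_S_eq[OF assms, folded \<tau>_def]
  have \<tau>0: "\<tau> > 0" using \<tau> pos gu by simp
  have lt: "lead_time \<mu> ((\<Lambda> + \<tau>) / \<mu>) \<Lambda> = 1 / \<tau>" using pos by (simp add: lead_time_def)
  have LW: "LW_S V \<Lambda> \<mu> w = (\<Lambda> + \<tau>) / \<mu> * (w - w\<^sup>2 / 2)"
    using pos by (simp add: LW_S_def opt(1) integral_ident_from_0 algebra_simps)
  moreover have "(\<Lambda> + \<tau>) / \<mu> = g\<^sup>2 + g / u"
    unfolding \<tau> L using pos gu by (simp add: field_simps power2_eq_square)
  moreover have "g / u * (w - w\<^sup>2 / 2) = g * (u - w * u / 2)"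
    unfolding w using gu by (simp add: field_simps power2_eq_square)
  ultimately have LW': "LW_S V \<Lambda> \<mu> w = g\<^sup>2 * (w - w\<^sup>2 / 2) + g * (u - w * u / 2)"
    by (simp add: distrib_right)
  then show "LW_S V \<Lambda> \<mu> w = \<Lambda> / \<mu> * (w - w\<^sup>2 / 2) + sqrt (\<Lambda> / \<mu>) * (sqrt w - w * sqrt w / 2)"
    using pos by (simp add: g_def u_def)
  have "CS_S V \<Lambda> \<mu> w = \<Lambda> * (1 / \<tau>) * 1\<^sup>2 / 2"
    unfolding CS_S_def opt(1) prod.case lt
    by (rule consumer_surplus_eq) (use \<tau>0 in auto)
  also have "\<dots> = g * u / 2"
    unfolding \<tau> L using pos gu by (simp add: field_simps power2_eq_square)
  finally have CS': "CS_S V \<Lambda> \<mu> w = g * u / 2" .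
  then show "CS_S V \<Lambda> \<mu> w = sqrt (\<Lambda> / \<mu>) * sqrt w / 2"
    by (simp add: g_def u_def)
  have "\<Lambda> * (u\<^sup>2 / \<mu> + 2 * u / (\<mu> * g)) = g\<^sup>2 * w + 2 * g * u"
    unfolding w L using pos gu by (simp add: field_simps power2_eq_square)
  then have "SW_S V \<Lambda> \<mu> w = \<Lambda> * V - g * u / 2 - g\<^sup>2 * w\<^sup>2 / 2 - g * (w * u) / 2"
    unfolding SW_S_def opt(2) LW' CS' C by (simp add: algebra_simps)
  then show "SW_S V \<Lambda> \<mu> w = \<Lambda> * V - sqrt (\<Lambda> / \<mu>) * sqrt w / 2 - \<Lambda> / \<mu> * w\<^sup>2 / 2
      - sqrt (\<Lambda> / \<mu>) * (w * sqrt w) / 2"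
    using pos by (simp add: g_def u_def)
qed

lemma Cbar_mono:
  assumes "\<Lambda> > 0" "\<mu> > 0" "v \<le> w"
  shows "Cbar \<Lambda> \<mu> v \<le> Cbar \<Lambda> \<mu> w"
proof -
  have "v / \<mu> \<le> w / \<mu>" and "v / (\<Lambda> * \<mu>) \<le> w / (\<Lambda> * \<mu>)"
    using assms by (simp_all add: divide_right_mono)
  then show ?thesis by (simp add: Cbar_def add_mono)
qed

text \<open>On positive wages \<open>sqrt w\<close> is concave and \<open>w * sqrt w\<close> is
  convex. \<open>?g\<close> and \<open>?h\<close> are the first two derivatives of the negated
  function, and every term of \<open>?h\<close> is nonnegative.\<close>

lemma labor_welfare_concave:
  fixes A B :: real
  assumes "A \<ge> 0" "B \<ge> 0"
  shows "concave_on {0<..} (\<lambda>w. A * (w - w\<^sup>2 / 2) + B * (sqrt w - w * sqrt w / 2))"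
proof -
  let ?g = "\<lambda>w. - (A * (1 - w) + B * (inverse (sqrt w) / 2 - 3 / 4 * sqrt w))"
  let ?h = "\<lambda>w. A + B * (inverse (sqrt w) ^ 3 / 4 + 3 / 8 * inverse (sqrt w))"
  have "convex_on {0<..} (\<lambda>w. - (A * (w - w\<^sup>2 / 2) + B * (sqrt w - w * sqrt w / 2)))"
  proof (rule f''_ge0_imp_convex)
    show "convex {0::real<..}" by simp
    fix w :: real assume w: "w \<in> {0<..}"
    have *: "((\<lambda>w. w * sqrt w) has_real_derivative 3 / 2 * sqrt w) (at w)"
    proof -
      have "inverse (sqrt w) * w = sqrt w"
        using w by (auto simp: field_simps)
      then show ?thesis using w by (auto intro!: derivative_eq_intros)
    qed
    have inv: "w * inverse (sqrt w) = sqrt w"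
      using w by (auto simp: field_simps)
    show "((\<lambda>w. - (A * (w - w\<^sup>2 / 2) + B * (sqrt w - w * sqrt w / 2)))
        has_real_derivative ?g w) (at w)"
      using w by (auto intro!: derivative_eq_intros * simp: algebra_simps inv)
    show "(?g has_real_derivative ?h w) (at w)"
      using w by (auto intro!: derivative_eq_intros simp: algebra_simps power3_eq_cube)
    show "0 \<le> ?h w" using w assms by auto
  qed
  then show ?thesis by (simp add: concave_on_def)
qed

section \<open>Contractors\<close>

text \<open>
  The reference point \<open>(X, t)\<close> stands for arrival rate \<open>\<Lambda> * X\<close> and lead time \<open>1 / (X * t)\<close>.
  The two squares are the gaps between the convex functions \<open>x\<^sup>2 / d\<close> and \<open>(l + d)\<^sup>2\<close> and their
  tangents at the reference point; the third term is linear in \<open>l\<close>.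
\<close>

lemma profit_O_eq:
  assumes pos: "\<Lambda> > 0" "\<mu> > 0" "K > 0" "X > 0" "t > 0"
    and bal: "2 * X * t\<^sup>2 * (\<Lambda> + t) = \<Lambda> * K * \<mu>\<^sup>2"
    and feas: "feasible_O V \<Lambda> \<mu> K (p, w, k, l)" and "l > 0"
  defines "d \<equiv> k * \<mu> - l" and "c \<equiv> V - 2 / t - \<Lambda> / t\<^sup>2"
  shows "profit_O (p, w, k, l) = \<Lambda> * X * c + X * \<Lambda> * (\<Lambda> + t) / (2 * t\<^sup>2)
      - c * (\<Lambda> * X - l) - (l * t - \<Lambda> * d)\<^sup>2 / (\<Lambda> * d * t\<^sup>2)
      - (l + d - X * (\<Lambda> + t))\<^sup>2 / (K * \<mu>\<^sup>2) - l * (V - l / (\<Lambda> * d) - p)"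
proof -
  have d: "d > 0" and wage: "l * w = k\<^sup>2 / K" using assms by (auto simp: d_def field_simps)
  define s M where "s = X * (\<Lambda> + t)" and "M = K * \<mu>\<^sup>2"
  have M: "M > 0" and balM: "2 * s * t\<^sup>2 = \<Lambda> * M"
    using pos bal by (auto simp: s_def M_def mult_ac distrib_left distrib_right)
  have k: "k\<^sup>2 / K = (l + d)\<^sup>2 / M"
    using pos by (simp add: d_def M_def power_mult_distrib)
  \<comment> \<open>\<open>s\<close> is the total capacity \<open>l + d\<close> at the reference
    point and \<open>2 * s / M\<close> its marginal wage cost. The balance condition equates this
    with \<open>\<Lambda> / t\<^sup>2\<close>, the marginal revenue of \<open>d\<close>.\<close>
  have s1: "2 * s / M = \<Lambda> / t\<^sup>2"
    using balM M pos by (simp add: field_simps)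
  have "(l + d - s)\<^sup>2 / M = (l + d)\<^sup>2 / M - (l + d) * (2 * s / M) + s * (2 * s / M) / 2"
    using M by (simp add: field_simps power2_eq_square)
  also have "s * (2 * s / M) / 2 = X * \<Lambda> * (\<Lambda> + t) / (2 * t\<^sup>2)"
    unfolding s1 by (simp add: s_def mult_ac)
  finally have 1: "(l + d - s)\<^sup>2 / M
    = (l + d)\<^sup>2 / M - (l + d) * (\<Lambda> / t\<^sup>2) + X * \<Lambda> * (\<Lambda> + t) / (2 * t\<^sup>2)"
    unfolding s1 .
  have 2: "(l * t - \<Lambda> * d)\<^sup>2 / (\<Lambda> * d * t\<^sup>2) = l * (l / (\<Lambda> * d)) - 2 * l / t + d * (\<Lambda> / t\<^sup>2)"
    using pos d by (simp add: field_simps power2_eq_square)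
  show ?thesis
    unfolding profit_O.simps wage k 2 1[unfolded s_def M_def] c_def M_def
    by (simp add: algebra_simps add_divide_distrib diff_divide_distrib)
qed

text \<open>\<open>bal\<close> is the first-order condition in \<open>d\<close>. The expression in
  \<open>c0\<close> is the marginal profit in \<open>l\<close> at the reference point, and
  \<open>c1\<close> is complementary slackness for \<open>l \<le> \<Lambda>\<close>. These
  conditions suffice because \<open>profit_O_eq\<close> subtracts four terms that they make
  nonnegative.\<close>

lemma optimal_O_eq:
  assumes pos: "\<Lambda> > 0" "\<mu> > 0" "K > 0" "0 < X" "X \<le> 1" "t > 0"
    and bal: "2 * X * t\<^sup>2 * (\<Lambda> + t) = \<Lambda> * K * \<mu>\<^sup>2"
    and c0: "V - 2 / t - \<Lambda> / t\<^sup>2 \<ge> 0" and c1: "V - 2 / t - \<Lambda> / t\<^sup>2 = 0 \<or> X = 1"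
  shows "optimal_O V \<Lambda> \<mu> K =
      (V - 1 / t, (X * (\<Lambda> + t) / \<mu>)\<^sup>2 / (K * (\<Lambda> * X)), X * (\<Lambda> + t) / \<mu>, \<Lambda> * X)"
    and "profit_opt_O V \<Lambda> \<mu> K =
      \<Lambda> * X * (V - 2 / t - \<Lambda> / t\<^sup>2) + X * \<Lambda> * (\<Lambda> + t) / (2 * t\<^sup>2)"
proof -
  define c where "c = V - 2 / t - \<Lambda> / t\<^sup>2"
  define p0 k0 l0 where "p0 = V - 1 / t" and "k0 = X * (\<Lambda> + t) / \<mu>" and "l0 = \<Lambda> * X"
  \<comment> \<open>The wage that solves the participation condition at \<open>k0\<close> and
    \<open>l0\<close>.\<close>
  define w0 where "w0 = k0\<^sup>2 / (K * l0)"
  define P where "P = \<Lambda> * X * c + X * \<Lambda> * (\<Lambda> + t) / (2 * t\<^sup>2)"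
  have l0: "l0 > 0" "l0 \<le> \<Lambda>" using pos by (auto simp: l0_def mult_le_cancel_left2)
  have d0: "k0 * \<mu> - l0 = X * t" using pos by (simp add: k0_def l0_def distrib_left)
  have Xt: "X * t > 0" and k0: "k0 \<ge> 0" using pos by (simp_all add: k0_def)
  have less: "k0 * \<mu> > l0" using d0 Xt by linarith
  have p0: "p0 = V - l0 / (\<Lambda> * (X * t))" using pos by (simp add: p0_def l0_def)
  have "demand V \<Lambda> p0 (lead_time \<mu> k0 l0) = l0"
    unfolding lead_time_def d0 using demand_at_marginal_price[OF l0 Xt p0] .
  then have feas0: "feasible_O V \<Lambda> \<mu> K (p0, w0, k0, l0)"
    using less l0 k0 pos by (simp add: w0_def)
  have "l0 + X * t = X * (\<Lambda> + t)" by (simp add: l0_def algebra_simps)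
  then have val0: "profit_O (p0, w0, k0, l0) = P"
    using profit_O_eq[OF pos(1-4,6) bal feas0 l0(1)] p0
    by (simp only: d0) (simp add: P_def c_def l0_def)
  have P: "profit_O (p, w, k, l) \<le> P \<and> (profit_O (p, w, k, l) = P \<longrightarrow> (p, w, k, l) = (p0, w0, k0, l0))"
    if feas: "feasible_O V \<Lambda> \<mu> K (p, w, k, l)" for p w k l
  proof -
    define d where "d = k * \<mu> - l"
    have d: "d > 0" "demand V \<Lambda> p (1 / d) = l"
      using feas by (auto simp: d_def lead_time_def)
    note pr = price_le_of_demand[OF pos(1) d]
    \<comment> \<open>Without customers, participation gives \<open>k = 0\<close>, so there is no
      excess capacity.\<close>
    have "l \<noteq> 0" using feas by auto
    then have l: "l > 0" using pr(1) by simp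
    define A B C D where "A = c * (\<Lambda> * X - l)"
      and "B = (l * t - \<Lambda> * d)\<^sup>2 / (\<Lambda> * d * t\<^sup>2)"
      and "C = (l + d - X * (\<Lambda> + t))\<^sup>2 / (K * \<mu>\<^sup>2)" and "D = l * (V - l / (\<Lambda> * d) - p)"
    have eq: "profit_O (p, w, k, l) = P - A - B - C - D"
      using profit_O_eq[OF pos(1-4,6) bal feas l]
      by (simp add: A_def B_def C_def D_def P_def c_def d_def)
    have nn: "A \<ge> 0" "B \<ge> 0" "C \<ge> 0" "D \<ge> 0"
      using pr(2) pr(3)[OF l] c0 c1 d pos l by (auto simp: A_def B_def C_def D_def c_def)
    have "(p, w, k, l) = (p0, w0, k0, l0)" if "profit_O (p, w, k, l) = P"
    proof -
      \<comment> \<open>If \<open>c = 0\<close>, the term \<open>A\<close> says nothing about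
        \<open>l\<close>. The two squares fix the ratio of \<open>l\<close> to \<open>d\<close> and
        their sum, hence both.\<close>
      have "B = 0" "C = 0" "D = 0" using eq nn that by linarith+
      have dl: "\<Lambda> * d = l * t" using \<open>B = 0\<close> pos d by (simp add: B_def)
      have sum: "l + d = X * (\<Lambda> + t)" using \<open>C = 0\<close> pos by (simp add: C_def)
      have "l * (\<Lambda> + t) = \<Lambda> * (l + d)" using dl by (simp add: algebra_simps)
      then have "l * (\<Lambda> + t) = l0 * (\<Lambda> + t)" unfolding sum by (simp add: l0_def)
      then have "l = l0" using pos by simp
      have "k * \<mu> = l + d" by (simp add: d_def)
      then have "k = k0" using sum pos by (simp add: k0_def field_simps)
      have "d = X * t" using d0 \<open>l = l0\<close> \<open>k = k0\<close> by (simp add: d_def)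
      have "p = p0" using \<open>D = 0\<close> l p0 \<open>l = l0\<close> \<open>d = X * t\<close> by (simp add: D_def)
      moreover have "w = w0" using feas \<open>k = k0\<close> \<open>l = l0\<close> l pos by (simp add: w0_def)
      ultimately show ?thesis using \<open>l = l0\<close> \<open>k = k0\<close> by simp
    qed
    then show ?thesis using eq nn by linarith
  qed
  have max: "profit_O y \<le> P" if "feasible_O V \<Lambda> \<mu> K y" for y
    using P that by (metis prod_cases4)
  have opt: "optimal_O V \<Lambda> \<mu> K = (p0, w0, k0, l0)"
    unfolding optimal_O_def
  proof (rule the_equality)
    show "is_arg_max profit_O (feasible_O V \<Lambda> \<mu> K) (p0, w0, k0, l0)"
      unfolding is_arg_max_def using feas0 val0 max by (metis not_le)
  next
    fix x assume x: "is_arg_max profit_O (feasible_O V \<Lambda> \<mu> K) x"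
    obtain p w k l where xe: "x = (p, w, k, l)" by (cases x)
    have feas: "feasible_O V \<Lambda> \<mu> K (p, w, k, l)"
      and "\<not> profit_O (p0, w0, k0, l0) > profit_O (p, w, k, l)"
      using x feas0 unfolding xe is_arg_max_def by blast+
    then have "profit_O (p, w, k, l) = P"
      using val0 P[OF feas] by linarith
    then show "x = (p0, w0, k0, l0)" using P[OF feas] xe by blast
  qed
  then show "optimal_O V \<Lambda> \<mu> K =
      (V - 1 / t, (X * (\<Lambda> + t) / \<mu>)\<^sup>2 / (K * (\<Lambda> * X)), X * (\<Lambda> + t) / \<mu>, \<Lambda> * X)"
    by (simp add: p0_def w0_def k0_def l0_def)
  show "profit_opt_O V \<Lambda> \<mu> K =
      \<Lambda> * X * (V - 2 / t - \<Lambda> / t\<^sup>2) + X * \<Lambda> * (\<Lambda> + t) / (2 * t\<^sup>2)"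
    using opt val0 by (simp only: profit_opt_O_def P_def c_def)
qed

text \<open>Eliminating \<open>K\<close> through \<open>bal\<close> leaves \<open>X\<close> times a
  function of \<open>t\<close> alone.\<close>

lemma welfare_O:
  assumes pos: "\<Lambda> > 0" "\<mu> > 0" "K > 0" "0 < X" "X \<le> 1" "t > 0"
    and bal: "2 * X * t\<^sup>2 * (\<Lambda> + t) = \<Lambda> * K * \<mu>\<^sup>2"
    and c0: "V - 2 / t - \<Lambda> / t\<^sup>2 \<ge> 0" and c1: "V - 2 / t - \<Lambda> / t\<^sup>2 = 0 \<or> X = 1"
  shows "LW_O V \<Lambda> \<mu> K = X * (\<Lambda> / (4 * t) + \<Lambda>\<^sup>2 / (4 * t\<^sup>2))"
    and "CS_O V \<Lambda> \<mu> K = X * (\<Lambda> / (2 * t))"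
    and "SW_O V \<Lambda> \<mu> K = X * (\<Lambda> * (V - 3 / (4 * t) - \<Lambda> / (4 * t\<^sup>2)))"
proof -
  define k where "k = X * (\<Lambda> + t) / \<mu>"
  note opt = optimal_O_eq[OF assms, folded k_def]
  have k: "k > 0" using pos by (simp add: k_def)
  \<comment> \<open>By participation, the hourly earnings of a contractor equal
    \<open>k / K\<close>.\<close>
  have rate: "\<Lambda> * X * (k\<^sup>2 / (K * (\<Lambda> * X))) / k = k / K"
    using pos k by (simp add: power2_eq_square)
  have "LW_O V \<Lambda> \<mu> K = K * ((k / K)\<^sup>2 / 2)"
    unfolding LW_O_def opt(1) prod.case rate using pos k by (simp add: integral_ident_from_0(2))
  also have "\<dots> = (X * (\<Lambda> + t))\<^sup>2 / (2 * (K * \<mu>\<^sup>2))"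
    using pos by (simp add: k_def power_divide power2_eq_square mult_ac)
  also have "K * \<mu>\<^sup>2 = 2 * X * t\<^sup>2 * (\<Lambda> + t) / \<Lambda>"
    using bal pos by (simp add: field_simps)
  also have "(X * (\<Lambda> + t))\<^sup>2 / (2 * (2 * X * t\<^sup>2 * (\<Lambda> + t) / \<Lambda>)) = X * (\<Lambda> * (\<Lambda> + t) / (4 * t\<^sup>2))"
    using pos by (simp add: power2_eq_square)
  also have "\<Lambda> * (\<Lambda> + t) / (4 * t\<^sup>2) = \<Lambda> / (4 * t) + \<Lambda>\<^sup>2 / (4 * t\<^sup>2)"
    using pos by (simp add: field_simps power2_eq_square)
  finally show LW: "LW_O V \<Lambda> \<mu> K = X * (\<Lambda> / (4 * t) + \<Lambda>\<^sup>2 / (4 * t\<^sup>2))" .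
  have "k * \<mu> - \<Lambda> * X = X * t" using pos by (simp add: k_def distrib_left)
  then have "lead_time \<mu> k (\<Lambda> * X) = 1 / (X * t)" by (simp add: lead_time_def)
  then have "CS_O V \<Lambda> \<mu> K = \<Lambda> * (1 / (X * t)) * X\<^sup>2 / 2"
    using pos consumer_surplus_eq[of "1 / (X * t)" X V "V - 1 / t" \<Lambda>]
    by (simp add: CS_O_def opt(1))
  then show CS: "CS_O V \<Lambda> \<mu> K = X * (\<Lambda> / (2 * t))"
    using pos by (simp add: power2_eq_square mult_ac)
  have "X * \<Lambda> * (\<Lambda> + t) / (2 * t\<^sup>2) = X * (\<Lambda>\<^sup>2 / (2 * t\<^sup>2) + \<Lambda> / (2 * t))"
    using pos by (simp add: field_simps power2_eq_square)
  then show "SW_O V \<Lambda> \<mu> K = X * (\<Lambda> * (V - 3 / (4 * t) - \<Lambda> / (4 * t\<^sup>2)))"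
    unfolding SW_O_def LW CS opt(2) using pos
    by (simp add: field_simps power2_eq_square)
qed

text \<open>Solves the conditions of \<open>optimal_O_eq\<close> for every \<open>K\<close>. While
  \<open>X < 1\<close> the marginal profit in \<open>l\<close> must vanish, which fixes
  \<open>t = t0\<close> and makes the balance linear in \<open>X\<close>; once \<open>X = 1\<close>
  the balance determines \<open>t\<close>.\<close>

lemma optimal_reference_point:
  fixes V \<Lambda> \<mu> :: real
  assumes pos: "V > 0" "\<Lambda> > 0" "\<mu> > 0"
  obtains X t :: "real \<Rightarrow> real" and a t0 :: real
  where "a > 0" "t0 > 0" "continuous_on {0<..} X" "continuous_on {0<..} t"
    and "V = 2 / t0 + \<Lambda> / t0\<^sup>2"
    and "\<And>K. 0 < K \<Longrightarrow> 0 < X K \<and> X K \<le> 1 \<and> t0 \<le> t K \<and>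
      2 * X K * (t K)\<^sup>2 * (\<Lambda> + t K) = \<Lambda> * K * \<mu>\<^sup>2"
    and "\<And>K. 0 < K \<Longrightarrow> K \<le> a \<Longrightarrow> t K = t0" "mono_on {0<..} X" "mono_on {0<..} t"
    and "\<And>K. a \<le> K \<Longrightarrow> X K = 1"
proof -
  \<comment> \<open>The positive root of \<open>V * t\<^sup>2 = 2 * t + \<Lambda>\<close>.\<close>
  define t0 where "t0 = (1 + sqrt (1 + \<Lambda> * V)) / V"
  \<comment> \<open>\<open>h t\<close> is the pool size that balances \<open>t\<close> with
    \<open>X = 1\<close>; thus \<open>a\<close> is where \<open>X\<close> reaches 1.\<close>
  define h where "h t = 2 * t\<^sup>2 * (\<Lambda> + t) / (\<Lambda> * \<mu>\<^sup>2)" for t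
  define a where "a = h t0"
  have t0: "t0 > 0" using pos by (simp add: t0_def add_pos_nonneg)
  have a: "a > 0" using t0 pos by (simp add: a_def h_def)
  have sqrt: "sqrt (1 + \<Lambda> * V) * sqrt (1 + \<Lambda> * V) = 1 + \<Lambda> * V" using pos by simp
  have "V * (V * t0\<^sup>2) = (1 + sqrt (1 + \<Lambda> * V))\<^sup>2"
    using pos by (simp add: t0_def power_divide power2_eq_square)
  also have "\<dots> = 2 * (1 + sqrt (1 + \<Lambda> * V)) + \<Lambda> * V"
    unfolding power2_eq_square distrib_left distrib_right sqrt by simp
  also have "\<dots> = V * (2 * t0 + \<Lambda>)"
    using pos by (simp add: t0_def field_simps)
  finally have "V * t0\<^sup>2 = 2 * t0 + \<Lambda>" using pos by simp
  then have V: "V = 2 / t0 + \<Lambda> / t0\<^sup>2"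
    using t0 by (simp add: field_simps power2_eq_square)
  have h_less: "h x < h y" if "0 < x" "x < y" for x y
  proof -
    have "2 * x\<^sup>2 * (\<Lambda> + x) < 2 * y\<^sup>2 * (\<Lambda> + y)"
      using that pos power_strict_mono[of x y 2] by (intro mult_strict_mono[of "2 * x\<^sup>2"]) auto
    then show ?thesis
      unfolding h_def using pos by (intro divide_strict_right_mono) auto
  qed
  have h_le: "h x \<le> h y \<longleftrightarrow> x \<le> y" if "0 < x" "0 < y" for x y
    using h_less[of x y] h_less[of y x] that by (cases x y rule: linorder_cases) auto
  have "\<exists>t>0. h t = K" if K: "K > 0" for K
  proof -
    \<comment> \<open>Chosen so that \<open>h b = 2 * K * (\<Lambda> + b) / \<Lambda>\<close>, which
      is at least \<open>K\<close>.\<close>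
    define b where "b = \<mu> * sqrt K"
    have b: "b > 0" "b\<^sup>2 = \<mu>\<^sup>2 * K" using K pos by (auto simp: b_def power_mult_distrib)
    have "K * (\<Lambda> * \<mu>\<^sup>2) \<le> 2 * b\<^sup>2 * (\<Lambda> + b)" using b K pos by (simp add: algebra_simps)
    then have "K \<le> h b" using pos by (simp add: h_def pos_le_divide_eq)
    moreover have "h 0 \<le> K" using K by (simp add: h_def)
    moreover have "continuous_on {0..b} h" unfolding h_def using pos by (intro continuous_intros) auto
    ultimately obtain t where "0 \<le> t" "h t = K" using IVT'[of h 0 K b] b by auto
    moreover have "t \<noteq> 0" using \<open>h t = K\<close> K by (auto simp: h_def)
    ultimately show ?thesis by (intro exI[of _ t]) auto
  qed
  then obtain g where g: "\<And>K. K > 0 \<Longrightarrow> g K > 0" "\<And>K. K > 0 \<Longrightarrow> h (g K) = K" by metis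
  have g_le: "g x \<le> g y \<longleftrightarrow> x \<le> y" if "0 < x" "0 < y" for x y
    using h_le[of "g x" "g y"] g that by simp
  have h_pos: "h t > 0" if "t > 0" for t using that pos by (simp add: h_def)
  have gh: "g (h t) = t" if "t > 0" for t
    using h_le[of "g (h t)" t] h_le[of t "g (h t)"] g h_pos that by (simp add: antisym)
  have "g ` {0<..} = {0<..}"
    using g gh h_pos by (force simp: image_iff)
  \<comment> \<open>An increasing map onto an open interval has no jumps.\<close>
  then have contg: "continuous_on {0<..} g"
    by (intro continuous_onI_mono) (auto simp: g_le)
  define X t where "X K = min 1 (K / a)" and "t K = max t0 (g K)" for K
  have ga: "g a = t0" using gh t0 by (simp add: a_def)
  show ?thesis
  proof (rule that[of a t0 X t])
    show "continuous_on {0<..} X" unfolding X_def using a by (auto intro!: continuous_intros)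
    show "continuous_on {0<..} t" unfolding t_def by (intro continuous_intros contg)
    show "mono_on {0<..} X" unfolding X_def using a
      by (intro mono_onI min.mono order_refl divide_right_mono) auto
    show "mono_on {0<..} t" unfolding t_def
      by (intro mono_onI max.mono order_refl) (simp add: g_le)
    show "X K = 1" if "a \<le> K" for K using that a by (simp add: X_def)
    show tK: "t K = t0" if "0 < K" "K \<le> a" for K
      using that a g_le[of K a] ga by (simp add: t_def)
    fix K :: real assume K: "0 < K"
    have "X K * h (t K) = K"
    proof (cases "K \<le> a")
      case True
      then show ?thesis using K a tK by (simp add: X_def flip: a_def)
    next
      case False
      then have "t K = g K" using K a g_le[of a K] ga by (simp add: t_def)
      then show ?thesis using False K a g by (simp add: X_def)
    qed
    then have "X K * (2 * (t K)\<^sup>2 * (\<Lambda> + t K)) = K * (\<Lambda> * \<mu>\<^sup>2)"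
      using pos by (simp add: h_def field_simps)
    then show "0 < X K \<and> X K \<le> 1 \<and> t0 \<le> t K \<and>
      2 * X K * (t K)\<^sup>2 * (\<Lambda> + t K) = \<Lambda> * K * \<mu>\<^sup>2"
      using K a by (simp add: X_def t_def mult_ac)
  qed (use a t0 V in auto)
qed

text \<open>Up to \<open>a\<close> only \<open>X\<close> moves and beyond \<open>a\<close> only
  \<open>t\<close>, so the product form yields the shapes from the monotonicity of the factors
  \<open>fL\<close>, \<open>fC\<close> and \<open>fS\<close> in \<open>t\<close>.\<close>

lemma welfare_O_shape:
  fixes V \<Lambda> \<mu> :: real
  assumes pos: "V > 0" "\<Lambda> > 0" "\<mu> > 0"
  obtains a where "a > 0"
    and "continuous_on {0<..} (LW_O V \<Lambda> \<mu>)" "mono_on {0<..a} (LW_O V \<Lambda> \<mu>)"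
      "antimono_on {a..} (LW_O V \<Lambda> \<mu>)"
    and "continuous_on {0<..} (CS_O V \<Lambda> \<mu>)" "mono_on {0<..a} (CS_O V \<Lambda> \<mu>)"
      "antimono_on {a..} (CS_O V \<Lambda> \<mu>)"
    and "continuous_on {0<..} (SW_O V \<Lambda> \<mu>)" "mono_on {0<..} (SW_O V \<Lambda> \<mu>)"
proof -
  obtain X t a t0 where a: "a > 0" "t0 > 0" and contX: "continuous_on {0<..} X"
    and contt: "continuous_on {0<..} t" and V: "V = 2 / t0 + \<Lambda> / t0\<^sup>2"
    and Xt: "\<And>K. 0 < K \<Longrightarrow> 0 < X K \<and> X K \<le> 1 \<and> t0 \<le> t K \<and>
      2 * X K * (t K)\<^sup>2 * (\<Lambda> + t K) = \<Lambda> * K * \<mu>\<^sup>2"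
    and t0: "\<And>K. 0 < K \<Longrightarrow> K \<le> a \<Longrightarrow> t K = t0"
    and mono: "mono_on {0<..} X" "mono_on {0<..} t"
    and X1: "\<And>K. a \<le> K \<Longrightarrow> X K = 1"
    using optimal_reference_point[OF pos] by metis
  have tpos: "t K > 0" if "K > 0" for K using Xt[OF that] a by linarith
  have slack: "V - 2 / s - \<Lambda> / s\<^sup>2 \<ge> 0" if "s \<ge> t0" for s
  proof -
    have "2 / s \<le> 2 / t0" "\<Lambda> / s\<^sup>2 \<le> \<Lambda> / t0\<^sup>2"
      using that a pos by (auto intro!: divide_left_mono power_mono)
    then show ?thesis using V by linarith
  qed
  have tight: "V - 2 / t K - \<Lambda> / (t K)\<^sup>2 = 0 \<or> X K = 1" if "K > 0" for K
    using t0[OF that] X1[of K] V by (cases "K \<le> a") auto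
  define fL fC fS where "fL s = \<Lambda> / (4 * s) + \<Lambda>\<^sup>2 / (4 * s\<^sup>2)" and "fC s = \<Lambda> / (2 * s)"
    and "fS s = \<Lambda> * (V - 3 / (4 * s) - \<Lambda> / (4 * s\<^sup>2))" for s
  have W: "LW_O V \<Lambda> \<mu> K = X K * fL (t K)" "CS_O V \<Lambda> \<mu> K = X K * fC (t K)"
    "SW_O V \<Lambda> \<mu> K = X K * fS (t K)" if "K > 0" for K
    using welfare_O[OF pos(2,3) that, of "X K" "t K" V] Xt[OF that] tpos[OF that]
      slack[of "t K"] tight[OF that]
    by (simp_all add: fL_def fC_def fS_def)
  have cont: "continuous_on {0<..} (\<lambda>K. X K * fL (t K))" "continuous_on {0<..} (\<lambda>K. X K * fC (t K))"
    "continuous_on {0<..} (\<lambda>K. X K * fS (t K))"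
    unfolding fL_def fC_def fS_def using tpos
    by (intro continuous_intros contX contt; force)+
  have incr: "mono_on {0<..a} (\<lambda>K. X K * f (t K))" if "f t0 \<ge> 0" for f :: "real \<Rightarrow> real"
    using that mono(1) t0 by (auto simp: mono_on_def intro!: mult_right_mono)
  have decr: "antimono_on {a..} (\<lambda>K. X K * f (t K))"
    if "\<And>x y. t0 \<le> x \<Longrightarrow> x \<le> y \<Longrightarrow> f y \<le> f x" for f :: "real \<Rightarrow> real"
  proof (rule monotone_onI)
    fix x y assume xy: "x \<in> {a..}" "y \<in> {a..}" "x \<le> y"
    then have "f (t y) \<le> f (t x)"
      using a Xt[of x] mono_onD[OF mono(2), of x y] by (intro that) auto
    then show "X x * f (t x) \<ge> X y * f (t y)" using xy X1 by simp
  qed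
  have le: "\<Lambda> / (c * y) \<le> \<Lambda> / (c * x)" "b / (c * y\<^sup>2) \<le> b / (c * x\<^sup>2)"
    if "t0 \<le> x" "x \<le> y" "c > 0" "b \<ge> 0" for b c x y
    using that a pos by (auto intro!: divide_left_mono mult_left_mono power_mono mult_pos_pos)
  have fS_mono: "fS x \<le> fS y" if "t0 \<le> x" "x \<le> y" for x y
  proof -
    have "3 / (4 * y) \<le> 3 / (4 * x)" using that a by (auto intro!: divide_left_mono)
    then show ?thesis
      unfolding fS_def using le(2)[OF that, of 4 \<Lambda>] pos by (intro mult_left_mono) auto
  qed
  \<comment> \<open>Both subtracted terms of \<open>fS\<close> are at most the summands of
    \<open>V\<close> at \<open>t0\<close>. Nonnegativity of \<open>fS\<close> lets the product of
    two increasing factors increase.\<close>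
  have "3 / (4 * t0) \<le> 2 / t0" "\<Lambda> / (4 * t0\<^sup>2) \<le> \<Lambda> / t0\<^sup>2"
    using a pos by (auto simp: field_simps)
  then have "fS t0 \<ge> 0" unfolding fS_def using slack[of t0] pos by simp
  have fL_anti: "fL y \<le> fL x" and fC_anti: "fC y \<le> fC x" if "t0 \<le> x" "x \<le> y" for x y
    unfolding fL_def fC_def
    using le(1)[OF that, of _ 0] le(2)[OF that, of 4 "\<Lambda>\<^sup>2"] by (auto intro!: add_mono)
  have nonneg: "fL t0 \<ge> 0" "fC t0 \<ge> 0" using a pos by (auto simp: fL_def fC_def)
  show ?thesis
  proof (rule that[OF a(1)])
    show "continuous_on {0<..} (LW_O V \<Lambda> \<mu>)" "continuous_on {0<..} (CS_O V \<Lambda> \<mu>)"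
      "continuous_on {0<..} (SW_O V \<Lambda> \<mu>)"
      using cont W by (auto intro: continuous_on_eq)
    show "mono_on {0<..a} (LW_O V \<Lambda> \<mu>)" "mono_on {0<..a} (CS_O V \<Lambda> \<mu>)"
      using incr[of fL] incr[of fC] nonneg W by (simp_all add: monotone_on_def)
    show "antimono_on {a..} (LW_O V \<Lambda> \<mu>)" "antimono_on {a..} (CS_O V \<Lambda> \<mu>)"
      using decr[of fL] decr[of fC] fL_anti fC_anti W a(1) by (simp_all add: monotone_on_def)
    show "mono_on {0<..} (SW_O V \<Lambda> \<mu>)"
    proof (rule mono_onI)
      fix x y :: real assume xy: "x \<in> {0<..}" "y \<in> {0<..}" "x \<le> y"
      then have "X x \<le> X y" "fS (t x) \<le> fS (t y)"
        using mono_onD[OF mono(1)] mono_onD[OF mono(2)] Xt[of x] by (auto intro: fS_mono)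
      moreover have "fS (t x) \<ge> 0"
        using \<open>fS t0 \<ge> 0\<close> fS_mono[of t0 "t x"] Xt[of x] xy by auto
      ultimately have "X x * fS (t x) \<le> X y * fS (t y)"
        using Xt[of y] xy by (intro mult_mono) auto
      then show "SW_O V \<Lambda> \<mu> x \<le> SW_O V \<Lambda> \<mu> y" using W xy by simp
    qed
  qed
qed

section \<open>Quasi-concavity and the thresholds as functions of the wage\<close>

lemma quasiconcave_on_if_concave_on:
  fixes f :: "'a::real_vector \<Rightarrow> real"
  assumes "concave_on S f"
  shows "quasiconcave_on S f"
  unfolding quasiconcave_on_def
proof (intro conjI ballI allI impI)
  show "convex S" using assms by (rule concave_on_imp_convex)
  fix x y u v assume xy: "x \<in> S" "y \<in> S" and uv: "0 \<le> u" "0 \<le> v" "u + v = (1::real)"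
  have "min (f x) (f y) = u * min (f x) (f y) + v * min (f x) (f y)"
    using uv by (simp flip: distrib_right)
  also have "\<dots> \<le> u * f x + v * f y"
    using uv by (intro add_mono mult_left_mono) auto
  also have "\<dots> \<le> f (u *\<^sub>R x + v *\<^sub>R y)"
    using assms xy uv unfolding concave_on_iff by blast
  finally show "min (f x) (f y) \<le> f (u *\<^sub>R x + v *\<^sub>R y)" .
qed

lemma quasiconcave_on_mono_comp:
  assumes f: "quasiconcave_on S f" and g: "mono g"
  shows "quasiconcave_on S (\<lambda>x. g (f x))"
  unfolding quasiconcave_on_def
proof (intro conjI ballI allI impI)
  show "convex S" using f by (simp add: quasiconcave_on_def)
  fix x y u v assume "x \<in> S" "y \<in> S" "0 \<le> u" "0 \<le> v" "u + v = (1::real)"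
  then have "min (f x) (f y) \<le> f (u *\<^sub>R x + v *\<^sub>R y)"
    using f unfolding quasiconcave_on_def by blast
  then show "min (g (f x)) (g (f y)) \<le> g (f (u *\<^sub>R x + v *\<^sub>R y))"
    using monoD[OF g] by (metis min_of_mono[OF g])
qed

text \<open>An antitone map exchanges minimum and maximum. This carries quasi-concavity of labor
  welfare in the wage over to the upper threshold.\<close>

lemma quasiconvex_on_antimono_comp:
  fixes g :: "'b::linorder \<Rightarrow> 'c::linorder"
  assumes f: "quasiconcave_on S f" and g: "antimono g"
  shows "quasiconvex_on S (\<lambda>x. g (f x))"
proof -
  have "max (g y) (g z) = g (min y z)" for y z
    using antimonoD[OF g, of y z] antimonoD[OF g, of z y]
    by (cases "y \<le> z") (auto simp: max_absorb1 max_absorb2 min_def)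
  then show ?thesis
    using f by (auto simp: quasiconcave_on_def quasiconvex_on_def intro!: antimonoD[OF g])
qed

theorem theorem2:
  fixes V \<Lambda> \<mu>s \<mu>o :: real
  assumes "V > 0" and "\<Lambda> > 0" and "\<mu>s > 0" and "\<mu>o > 0"
  defines "D \<equiv> {w. w > 0 \<and> V \<ge> Cbar \<Lambda> \<mu>s w}"
  shows "\<exists>KL_lo KL_up KC_lo KC_up KS :: real \<Rightarrow> ereal.
    (\<forall>w\<in>D. \<forall>K>0.
      (LW_O V \<Lambda> \<mu>o K > LW_S V \<Lambda> \<mu>s w \<longleftrightarrow> KL_lo w < ereal K \<and> ereal K < KL_up w) \<and>
      (CS_O V \<Lambda> \<mu>o K > CS_S V \<Lambda> \<mu>s w \<longleftrightarrow> KC_lo w < ereal K \<and> ereal K < KC_up w) \<and>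
      (SW_O V \<Lambda> \<mu>o K > SW_S V \<Lambda> \<mu>s w \<longleftrightarrow> ereal K > KS w)) \<and>
    (\<forall>w\<in>D. KL_lo w \<le> KL_up w \<and> KC_lo w \<le> KC_up w) \<and>
    quasiconcave_on D KL_lo \<and> quasiconvex_on D KL_up \<and>
    mono_on D KC_lo \<and> antimono_on D KC_up \<and> antimono_on D KS"
proof -
  obtain a where a: "a > 0"
    and L: "continuous_on {0<..} (LW_O V \<Lambda> \<mu>o)" "mono_on {0<..a} (LW_O V \<Lambda> \<mu>o)"
      "antimono_on {a..} (LW_O V \<Lambda> \<mu>o)"
    and C: "continuous_on {0<..} (CS_O V \<Lambda> \<mu>o)" "mono_on {0<..a} (CS_O V \<Lambda> \<mu>o)"
      "antimono_on {a..} (CS_O V \<Lambda> \<mu>o)"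
    and S: "continuous_on {0<..} (SW_O V \<Lambda> \<mu>o)" "mono_on {0<..} (SW_O V \<Lambda> \<mu>o)"
    using welfare_O_shape[OF assms(1,2,4)] by blast
  \<comment> \<open>The wage enters only through the welfare level under employees, so thresholds
    are first found as functions of an arbitrary level \<open>c\<close>.\<close>
  obtain loL upL where Lth: "\<And>c K. K > 0 \<Longrightarrow> c < LW_O V \<Lambda> \<mu>o K \<longleftrightarrow> loL c < ereal K \<and> ereal K < upL c"
    "\<And>c. loL c \<le> upL c" "mono loL" "antimono upL"
    using unimodal_superlevel[OF L(1) a L(2,3)] by blast
  obtain loC upC where Cth: "\<And>c K. K > 0 \<Longrightarrow> c < CS_O V \<Lambda> \<mu>o K \<longleftrightarrow> loC c < ereal K \<and> ereal K < upC c"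
    "\<And>c. loC c \<le> upC c" "mono loC" "antimono upC"
    using unimodal_superlevel[OF C(1) a C(2,3)] by blast
  obtain loS where Sth: "\<And>c K. K > 0 \<Longrightarrow> c < SW_O V \<Lambda> \<mu>o K \<longleftrightarrow> loS c < ereal K" "mono loS"
    using mono_superlevel[OF S] by blast
  note wel = welfare_S[OF assms(2,3)]
  \<comment> \<open>\<open>Cbar\<close> increases with the wage, so \<open>D\<close> is an
    interval.\<close>
  have "convex D"
    unfolding is_interval_convex_1[symmetric] is_interval_1 D_def
    using Cbar_mono[OF assms(2,3)] by (auto intro: order_trans)
  have "concave_on D (\<lambda>w. \<Lambda> / \<mu>s * (w - w\<^sup>2 / 2) + sqrt (\<Lambda> / \<mu>s) * (sqrt w - w * sqrt w / 2))"
    unfolding concave_on_def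
    by (rule convex_on_subset[OF labor_welfare_concave[unfolded concave_on_def] _ \<open>convex D\<close>])
      (use assms(2,3) in \<open>auto simp: D_def\<close>)
  \<comment> \<open>The closed form holds on \<open>D\<close>; convexity of \<open>D\<close> keeps
    the intermediate wages inside it.\<close>
  then have "concave_on D (LW_S V \<Lambda> \<mu>s)"
    using \<open>convex D\<close> wel(1) unfolding concave_on_iff
    by (auto simp: D_def convex_def)
  then have LWq: "quasiconcave_on D (LW_S V \<Lambda> \<mu>s)"
    by (rule quasiconcave_on_if_concave_on)
  have CSm: "CS_S V \<Lambda> \<mu>s x \<le> CS_S V \<Lambda> \<mu>s y" if "x \<in> D" "y \<in> D" "x \<le> y" for x y
    using that assms(2,3) by (auto simp: D_def wel(2) intro!: mult_left_mono divide_right_mono)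
  have SWm: "SW_S V \<Lambda> \<mu>s y \<le> SW_S V \<Lambda> \<mu>s x" if "x \<in> D" "y \<in> D" "x \<le> y" for x y
    using that assms(2,3)
    by (auto simp: D_def wel(3) intro!: mult_left_mono divide_right_mono diff_mono mult_mono power_mono)
  show ?thesis
  proof (intro exI conjI ballI allI impI)
    fix w K :: real assume "K > 0"
    note K = Lth(1)[OF this] Cth(1)[OF this] Sth(1)[OF this]
    show "LW_O V \<Lambda> \<mu>o K > LW_S V \<Lambda> \<mu>s w \<longleftrightarrow>
        loL (LW_S V \<Lambda> \<mu>s w) < ereal K \<and> ereal K < upL (LW_S V \<Lambda> \<mu>s w)"
      and "CS_O V \<Lambda> \<mu>o K > CS_S V \<Lambda> \<mu>s w \<longleftrightarrow>
        loC (CS_S V \<Lambda> \<mu>s w) < ereal K \<and> ereal K < upC (CS_S V \<Lambda> \<mu>s w)"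
      and "SW_O V \<Lambda> \<mu>o K > SW_S V \<Lambda> \<mu>s w \<longleftrightarrow> ereal K > loS (SW_S V \<Lambda> \<mu>s w)"
      by (fact K)+
  next
    fix w
    show "loL (LW_S V \<Lambda> \<mu>s w) \<le> upL (LW_S V \<Lambda> \<mu>s w)"
      and "loC (CS_S V \<Lambda> \<mu>s w) \<le> upC (CS_S V \<Lambda> \<mu>s w)"
      by (fact Lth(2) Cth(2))+
  next
    show "quasiconcave_on D (\<lambda>w. loL (LW_S V \<Lambda> \<mu>s w))"
      by (rule quasiconcave_on_mono_comp[OF LWq Lth(3)])
    show "quasiconvex_on D (\<lambda>w. upL (LW_S V \<Lambda> \<mu>s w))"
      by (rule quasiconvex_on_antimono_comp[OF LWq Lth(4)])
    show "mono_on D (\<lambda>w. loC (CS_S V \<Lambda> \<mu>s w))"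
      using CSm monoD[OF Cth(3)] by (intro mono_onI) blast
    show "antimono_on D (\<lambda>w. upC (CS_S V \<Lambda> \<mu>s w))"
      using CSm antimonoD[OF Cth(4)] by (intro monotone_onI) blast
    show "antimono_on D (\<lambda>w. loS (SW_S V \<Lambda> \<mu>s w))"
      using SWm monoD[OF Sth(2)] by (intro monotone_onI) blast
  qed
qed

end
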